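(* Let $D\subseteq\mathbf{N}_{>0}$ be finite, nonempty, and divisor-closed. For every prime power $q$ (a power of the prime $p$), every $e\geq 1$, and every $n\geq 2$, there is a polynomial $g_D\in\mathbf{F}_q[T]$ (with $g_D(0)=0$) such that $$\mathcal{S}_q(\Psi_{g_D,e,n})=D.$$ One may take $g_D$ to be the monic least common multiple $$g_D(T)=\operatorname{lcm}_{d\in\operatorname{Max}(D)}\bigl(T^{q^d}-T\bigr),$$ where $\operatorname{Max}(D)$ denotes the set of elements of $D$ that are maximal under divisibility.
   Context: $q=p^r$ is a prime power. For $g\in\mathbf{F}_q[T]$ with $g(0)=0$, $e\ge1$, $n\ge2$, define the polynomial map $\Psi_{g,e,n}(X_1,\ldots,X_n)=\bigl(X_1+(X_2\,g(X_1))^{p^e},X_2,\ldots,X_n\bigr)$. For a polynomial map $F\in\mathbf{F}_q[X_1,\ldots,X_n]^n$, its finite-extension permutation spectrum is $\mathcal{S}_q(F)=\{m\in\mathbf{N}_{>0}: F\colon\mathbf{F}_{q^m}^n\to\mathbf{F}_{q^m}^n\text{ is bijective}\}$. A set $D\subseteq\mathbf{N}_{>0}$ is divisor-closed if $m\in D$ and $d\mid m$ imply $d\in D$. *)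

theory Defs
  imports
    "HOL-Algebra.Algebraic_Closure_Type"
    "HOL-Library.Poly_Mapping"
    "HOL-Library.FuncSet"
    "HOL-Library.Cardinality"
begin

section \<open>Multivariate polynomials and polynomial maps\<close>

text \<open>
  Variables are indexed by natural numbers; a monomial is a finitely supported exponent vector.
  Multiplication on this type is the convolution product of \<^theory>\<open>HOL-Library.Poly_Mapping\<close>.
\<close>

type_synonym 'a mpoly = "(nat \<Rightarrow>\<^sub>0 nat) \<Rightarrow>\<^sub>0 'a"

definition Const :: "'a::comm_ring_1 \<Rightarrow> 'a mpoly" where
  "Const c = Poly_Mapping.single 0 c"

definition Var :: "nat \<Rightarrow> 'a::comm_ring_1 mpoly" where
  "Var i = Poly_Mapping.single (Poly_Mapping.single i 1) 1"

definition mpolys :: "nat \<Rightarrow> 'a::comm_ring_1 mpoly set" where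
  "mpolys n = {f. \<forall>m\<in>Poly_Mapping.keys f. Poly_Mapping.keys m \<subseteq> {1..n}}"

definition poly_maps :: "nat \<Rightarrow> (nat \<Rightarrow> 'a::comm_ring_1 mpoly) set" where
  "poly_maps n = ({1..n} \<rightarrow>\<^sub>E mpolys n)"

definition subst_poly :: "'a::comm_ring_1 poly \<Rightarrow> 'a mpoly \<Rightarrow> 'a mpoly" where
  "subst_poly g f = poly (map_poly Const g) f"

definition Psi :: "nat \<Rightarrow> 'a::comm_ring_1 poly \<Rightarrow> nat \<Rightarrow> nat \<Rightarrow> (nat \<Rightarrow> 'a mpoly)" where
  "Psi p g e n = (\<lambda>i\<in>{1..n}.
     if i = 1 then Var 1 + (Var 2 * subst_poly g (Var 1)) ^ (p ^ e) else Var i)"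


section \<open>Finite extensions and the permutation spectrum\<close>

text \<open>
  For a finite field \<open>'a\<close> with \<open>q\<close> elements, \<open>ext_field m\<close> is the field with \<open>q ^ m\<close> elements
  inside a fixed algebraic closure of \<open>'a\<close>. Lemma \<open>ext_field_unique\<close> below shows that for
  \<open>m > 0\<close> it is the only subfield of that cardinality.
\<close>

definition ext_field :: "nat \<Rightarrow> 'a::{field,finite} alg_closure set" where
  "ext_field m = {x. x ^ (CARD('a) ^ m) = x}"

definition mpoly_eval :: "(nat \<Rightarrow> 'a::field alg_closure) \<Rightarrow> 'a mpoly \<Rightarrow> 'a alg_closure" where
  "mpoly_eval x f = (\<Sum>m\<in>Poly_Mapping.keys f.
     to_ac (Poly_Mapping.lookup f m) *
     (\<Prod>i\<in>Poly_Mapping.keys m. x i ^ Poly_Mapping.lookup m i))"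

definition poly_map_eval ::
  "nat \<Rightarrow> (nat \<Rightarrow> 'a::field mpoly) \<Rightarrow> (nat \<Rightarrow> 'a alg_closure) \<Rightarrow> (nat \<Rightarrow> 'a alg_closure)" where
  "poly_map_eval n F x = (\<lambda>i\<in>{1..n}. mpoly_eval x (F i))"

definition spectrum :: "nat \<Rightarrow> (nat \<Rightarrow> 'a::{field,finite} mpoly) \<Rightarrow> nat set" where
  "spectrum n F = {m. m > 0 \<and>
     bij_betw (poly_map_eval n F) ({1..n} \<rightarrow>\<^sub>E ext_field m) ({1..n} \<rightarrow>\<^sub>E ext_field m)}"


section \<open>Divisor-closed sets and the polynomial \<open>g\<^sub>D\<close>\<close>

definition divisor_closed :: "nat set \<Rightarrow> bool" where
  "divisor_closed D \<longleftrightarrow> (\<forall>m\<in>D. \<forall>d. d dvd m \<longrightarrow> d \<in> D)"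

definition max_div :: "nat set \<Rightarrow> nat set" where
  "max_div D = {d\<in>D. \<forall>d'\<in>D. d dvd d' \<longrightarrow> d' = d}"

definition is_monic_lcm :: "'a::field poly set \<Rightarrow> 'a poly \<Rightarrow> bool" where
  "is_monic_lcm A L \<longleftrightarrow> lead_coeff L = 1 \<and> (\<forall>a\<in>A. a dvd L) \<and>
     (\<forall>M. (\<forall>a\<in>A. a dvd M) \<longrightarrow> L dvd M)"

text \<open>
  The library's \<^const>\<open>Lcm\<close> on polynomials needs the coefficient type to be in the class
  \<^class>\<open>field_gcd\<close>; to cover every finite field, the monic least common multiple is defined
  here for arbitrary fields. Lemma \<open>monic_lcm_eq_Lcm\<close> shows the agreement.
\<close>

definition monic_lcm :: "'a::field poly set \<Rightarrow> 'a poly" where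
  "monic_lcm A = (THE L. is_monic_lcm A L)"

definition g_D :: "nat set \<Rightarrow> 'a::{field,finite} poly" where
  "g_D D = monic_lcm ((\<lambda>d. monom 1 (CARD('a) ^ d) - monom 1 1) ` max_div D)"


section \<open>Well-definedness\<close>

lemma is_monic_lcm_unique:
  assumes "is_monic_lcm A L" "is_monic_lcm A L'"
  shows "L = L'"
proof -
  have "L dvd L'" "L' dvd L" "lead_coeff L = 1" "lead_coeff L' = 1"
    using assms by (auto simp: is_monic_lcm_def)
  then obtain k where k: "L' = L * k" and "L \<noteq> 0" "L' \<noteq> 0" by fastforce
  then have "k \<noteq> 0" by auto
  have "degree L' \<le> degree L"
    using \<open>L' dvd L\<close> \<open>L \<noteq> 0\<close> by (rule dvd_imp_degree_le)
  then have "degree k = 0"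
    using k \<open>L \<noteq> 0\<close> \<open>k \<noteq> 0\<close> by (simp add: degree_mult_eq)
  then obtain c where "k = [:c:]" by (rule degree_eq_zeroE)
  moreover from this have "c = 1"
    using k(1) \<open>lead_coeff L = 1\<close> \<open>lead_coeff L' = 1\<close>
    by (auto simp: lead_coeff_mult split: if_splits)
  ultimately show ?thesis
    using k by simp
qed

lemma is_monic_lcm_exists:
  fixes A :: "'a::field poly set"
  assumes "finite A" "0 \<notin> A"
  shows "\<exists>L. is_monic_lcm A L"
proof -
  define P where "P = (\<lambda>L::'a poly. L \<noteq> 0 \<and> (\<forall>a\<in>A. a dvd L))"
  have "P (\<Prod>A)"
    using assms by (auto simp: P_def)
  then obtain L0 where L0: "P L0" and min: "\<And>M. P M \<Longrightarrow> degree L0 \<le> degree M"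
    using ex_has_least_nat[of P _ degree] by blast
  define L where "L = smult (inverse (lead_coeff L0)) L0"
  have nz: "lead_coeff L0 \<noteq> 0"
    using L0 by (simp add: P_def)
  have "L0 dvd M" if M: "\<forall>a\<in>A. a dvd M" for M
  proof (rule ccontr)
    assume "\<not> L0 dvd M"
    then have nz': "M mod L0 \<noteq> 0"
      by (simp add: mod_eq_0_iff_dvd)
    have "\<forall>a\<in>A. a dvd M mod L0"
      using L0 M by (auto simp: P_def intro: dvd_mod)
    then have "degree L0 \<le> degree (M mod L0)"
      using nz' by (intro min) (simp add: P_def)
    moreover have "degree (M mod L0) < degree L0"
      using nz' L0 degree_mod_less[of L0 M] by (simp add: P_def)
    ultimately show False by simp
  qed
  then have "is_monic_lcm A L"
    using L0 nz by (auto simp: is_monic_lcm_def L_def P_def smult_dvd_iff dvd_smult)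
  then show ?thesis ..
qed

lemma is_monic_lcm_monic_lcm:
  assumes "finite A" "0 \<notin> A"
  shows "is_monic_lcm A (monic_lcm A)"
  unfolding monic_lcm_def
  using is_monic_lcm_exists[OF assms] is_monic_lcm_unique by (metis theI)

lemma monic_lcm_eq_Lcm:
  fixes A :: "'a::field_gcd poly set"
  assumes "finite A" "0 \<notin> A"
  shows "monic_lcm A = Lcm A"
proof -
  have nz: "Lcm A \<noteq> 0"
    using assms by (simp add: Lcm_0_iff)
  have "normalize (Lcm A) = Lcm A"
    by simp
  moreover have "lead_coeff (normalize (Lcm A)) = 1"
    using nz by (simp add: normalize_poly_eq_map_poly lead_coeff_map_poly_nz dvd_field_iff
        is_unit_normalize)
  ultimately have "is_monic_lcm A (Lcm A)"
    by (auto simp: is_monic_lcm_def dvd_Lcm intro: Lcm_least)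
  then show ?thesis
    using is_monic_lcm_unique is_monic_lcm_monic_lcm[OF assms] by blast
qed

lemma CARD_eq_CHAR_power:
  assumes "prime p" "CARD('a::{field,finite}) = p ^ r"
  shows "p = CHAR('a)"
proof -
  have "prime CHAR('a)"
    by (rule prime_CHAR_semidom) (rule finite_imp_CHAR_pos, simp)
  moreover have "CHAR('a) dvd p ^ r"
  proof -
    have "(\<Sum>x\<in>(UNIV::'a set). x + 1) = (\<Sum>x\<in>UNIV. x)"
      by (rule sum.reindex_bij_witness[of _ "\<lambda>x. x - 1" "\<lambda>x. x + 1"]) auto
    then have "of_nat (CARD('a)) = (0::'a)"
      by (simp add: sum.distrib)
    then show ?thesis
      using assms(2) by (metis of_nat_eq_0_iff_char_dvd)
  qed
  ultimately show ?thesis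
    using assms(1) by (metis prime_dvd_power primes_dvd_imp_eq)
qed

lemma ring_of_type_algebra_simps:
  defines "R \<equiv> (ring_of_type_algebra :: 'b::Fields.field ring)"
  shows "carrier R = UNIV" "monoid.mult R = (*)" "add R = (+)" "\<one>\<^bsub>R\<^esub> = 1" "\<zero>\<^bsub>R\<^esub> = 0"
    "a_inv R x = - x" "x \<noteq> 0 \<Longrightarrow> m_inv R x = inverse x"
proof -
  show *: "carrier R = UNIV" "monoid.mult R = (*)" "add R = (+)" "\<one>\<^bsub>R\<^esub> = 1" "\<zero>\<^bsub>R\<^esub> = 0"
    by (simp_all add: R_def ring_of_type_algebra_def)
  interpret R: Ring.field R
    unfolding R_def by (rule field_from_type_algebra)
  show "a_inv R x = - x"
    by (rule R.minus_equality) (simp_all add: *)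
  show "x \<noteq> 0 \<Longrightarrow> m_inv R x = inverse x"
    by (rule R.inv_unique'[symmetric]) (simp_all add: *)
qed

lemma pow_card_subfield:
  fixes K :: "'b::Fields.field set"
  assumes K: "subfield K ring_of_type_algebra" and fin: "finite K" and x: "x \<in> K"
  shows "x ^ card K = x"
proof (cases "x = 0")
  case True
  then show ?thesis
    using fin x by (cases "card K") auto
next
  case False
  let ?R = "ring_of_type_algebra :: 'b ring"
  interpret R: Ring.field ?R by (rule field_from_type_algebra)
  define U where "U = K - {0}"
  have mult: "a * b \<in> K" if "a \<in> K" "b \<in> K" for a b
    using that subringE(6)[OF subfieldE(1)[OF K]] by (simp add: ring_of_type_algebra_simps)
  have 0: "0 \<in> K"
    using subringE(2)[OF subfieldE(1)[OF K]] by (simp add: ring_of_type_algebra_simps)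
  have finU: "finite U" using fin by (simp add: U_def)
  have inj: "inj_on ((*) x) U"
    using False by (auto simp: inj_on_def)
  have "(*) x ` U \<subseteq> U"
    using x False mult by (auto simp: U_def)
  then have img: "(*) x ` U = U"
    using inj finU by (simp add: endo_inj_surj)
  have "\<Prod>U = (\<Prod>u\<in>U. x * u)"
    using prod.reindex[OF inj, of "\<lambda>u. u"] img by simp
  also have "\<dots> = x ^ card U * \<Prod>U"
    by (simp add: prod.distrib)
  finally have "x ^ card U = 1"
    using finU by (auto simp: U_def)
  moreover have "card K = Suc (card U)"
    unfolding U_def using fin 0 by (rule card.remove)
  ultimately show ?thesis by simp
qed

lemma card_ext_field:
  assumes "prime p" "CARD('a::{field,finite}) = p ^ r" "m > 0"
  shows "card (ext_field m :: 'a alg_closure set) = CARD('a) ^ m"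
proof -
  define Q where "Q = CARD('a) ^ m"
  define f :: "'a alg_closure poly" where "f = monom 1 Q - monom 1 1"
  have "CARD('a) > 1"
    using card_mono[of UNIV "{0,1::'a}"] by simp
  then have Q: "Q > 1"
    unfolding Q_def using assms(3) by (rule one_less_power)
  have f0: "f \<noteq> 0" and deg: "degree f = Q"
  proof -
    show *: "degree f = Q"
      using Q degree_add_eq_left[of "- monom 1 1" "monom 1 Q :: 'a alg_closure poly"]
      by (simp add: f_def degree_monom_eq)
    then show "f \<noteq> 0" using Q by auto
  qed
  have "of_nat Q = (0 :: 'a alg_closure)"
  proof -
    have p: "p = CHAR('a)"
      using assms(1,2) by (rule CARD_eq_CHAR_power)
    have "r > 0"
      using assms(2) \<open>CARD('a) > 1\<close> by (cases r) auto
    then have "p dvd Q"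
      using assms(2,3) by (simp add: Q_def flip: power_mult)
    then show ?thesis
      unfolding of_nat_eq_0_iff_char_dvd by (simp add: p)
  qed
  then have pderiv: "pderiv f = -1"
    by (simp add: f_def pderiv_diff pderiv_monom one_pCons)
  obtain A where A: "size A = Q" "f = smult (lead_coeff f) (\<Prod>x\<in>#A. [:-x, 1:])"
    using alg_closed_imp_factorization[OF f0] deg by auto
  have "poly f x = 0 \<longleftrightarrow> x \<in># A" for x
    using f0 by (subst A(2)) (auto simp: poly_prod_mset prod_mset_zero_iff image_iff)
  then have roots: "ext_field m = set_mset A"
    by (auto simp: ext_field_def f_def poly_monom Q_def)
  have "count A x \<le> 1" for x
  proof (rule ccontr)
    assume "\<not> count A x \<le> 1"
    then have "{#x, x#} \<subseteq># A"
      by (simp add: subseteq_mset_def)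
    then obtain B where "A = {#x, x#} + B"
      by (metis subset_mset.less_eqE)
    then have "[:-x, 1:] ^ 2 dvd f"
      by (subst A(2)) (intro dvd_smult, simp add: power2_eq_square flip: mult.assoc del: mult_pCons_left mult_pCons_right)
    then obtain h where "f = [:-x, 1:] ^ 2 * h" ..
    then have "poly (pderiv f) x = 0"
      by (simp add: pderiv_mult power2_eq_square del: mult_pCons_left mult_pCons_right)
    then show False
      by (simp add: pderiv)
  qed
  then have "count A x = 1" if "x \<in># A" for x
    using that by (metis One_nat_def Suc_leI count_greater_zero_iff le_antisym)
  then have "card (set_mset A) = size A"
    by (simp add: size_multiset_overloaded_eq)
  then show ?thesis
    using A(1) roots by (simp add: Q_def)
qed

lemma subfield_ext_field:
  assumes "prime p" "CARD('a::{field,finite}) = p ^ r"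
  shows "subfield (ext_field m :: 'a alg_closure set) ring_of_type_algebra"
proof -
  let ?R = "ring_of_type_algebra :: 'a alg_closure ring"
  interpret R: Ring.field ?R by (rule field_from_type_algebra)
  define Q where "Q = CARD('a) ^ m"
  have p: "p = CHAR('a)"
    using assms by (rule CARD_eq_CHAR_power)
  have Q: "Q = CHAR('a alg_closure) ^ (r * m)"
    using assms(2) by (simp add: Q_def p power_mult)
  have prime: "prime CHAR('a alg_closure)"
    using assms(1) by (simp add: p)
  have add: "(x + y) ^ Q = x ^ Q + y ^ Q" for x y :: "'a alg_closure"
    using prime Q by (rule freshmans_dream')
  have neg: "(- x) ^ Q = - (x ^ Q)" for x :: "'a alg_closure"
  proof -
    have "Q > 0" by (simp add: Q_def)
    then show ?thesis
      using add[of x "- x"] by (simp add: eq_neg_iff_add_eq_0 add.commute power_0_left)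
  qed
  have "subring (ext_field m) ?R"
    by (rule R.subringI)
       (auto simp: ring_of_type_algebra_simps ext_field_def add neg power_mult_distrib simp flip: Q_def)
  then show ?thesis
    by (rule R.subfieldI') (auto simp: ring_of_type_algebra_simps ext_field_def power_inverse)
qed

lemma ext_field_unique:
  fixes K :: "'a::{field,finite} alg_closure set"
  assumes "prime p" "CARD('a) = p ^ r" "m > 0"
  shows "subfield K ring_of_type_algebra \<and> card K = CARD('a) ^ m \<longleftrightarrow> K = ext_field m"
proof
  assume K: "subfield K ring_of_type_algebra \<and> card K = CARD('a) ^ m"
  then have "finite K"
    by (metis card.infinite power_not_zero zero_less_card_finite less_irrefl)
  then have "K \<subseteq> ext_field m"
    using K pow_card_subfield[of K] by (auto simp: ext_field_def)
  moreover have "card (ext_field m :: 'a alg_closure set) = CARD('a) ^ m"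
    using assms by (rule card_ext_field)
  moreover from this have "finite (ext_field m :: 'a alg_closure set)"
    by (metis card.infinite power_not_zero zero_less_card_finite less_irrefl)
  ultimately show "K = ext_field m"
    using K by (metis card_subset_eq)
next
  assume "K = ext_field m"
  then show "subfield K ring_of_type_algebra \<and> card K = CARD('a) ^ m"
    using card_ext_field[OF assms] subfield_ext_field[OF assms(1,2)] by simp
qed


section \<open>Evaluation is a ring homomorphism\<close>

lemma mpoly_eval_superset:
  assumes "finite S" "Poly_Mapping.keys f \<subseteq> S"
  shows "mpoly_eval x f = (\<Sum>m\<in>S. to_ac (Poly_Mapping.lookup f m) *
     (\<Prod>i\<in>Poly_Mapping.keys m. x i ^ Poly_Mapping.lookup m i))"
  unfolding mpoly_eval_def using assms
  by (intro sum.mono_neutral_left) (auto simp: in_keys_iff)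

lemma mpoly_eval_add: "mpoly_eval x (f + g) = mpoly_eval x f + mpoly_eval x g"
proof -
  let ?S = "Poly_Mapping.keys f \<union> Poly_Mapping.keys g"
  have "finite ?S" by simp
  then show ?thesis
    using Poly_Mapping.keys_add[of f g]
    by (simp add: mpoly_eval_superset[of ?S] lookup_add distrib_right sum.distrib)
qed

lemma mpoly_eval_sum: "mpoly_eval x (sum f A) = (\<Sum>a\<in>A. mpoly_eval x (f a))"
  by (induction A rule: infinite_finite_induct) (simp_all add: mpoly_eval_add, simp_all add: mpoly_eval_def)

lemma mpoly_eval_single: "mpoly_eval x (Poly_Mapping.single m c) =
    to_ac c * (\<Prod>i\<in>Poly_Mapping.keys m. x i ^ Poly_Mapping.lookup m i)"
  by (subst mpoly_eval_superset[of "{m}"]) auto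

lemma mpoly_eval_Var: "mpoly_eval x (Var i) = x i"
  by (simp add: Var_def mpoly_eval_single)

lemma mpoly_eval_Const: "mpoly_eval x (Const c) = to_ac c"
  by (simp add: Const_def mpoly_eval_single)

lemma mpoly_eq_sum_single:
  "f = (\<Sum>m\<in>Poly_Mapping.keys f. Poly_Mapping.single m (Poly_Mapping.lookup f m))"
  by (rule poly_mapping_eqI) (auto simp: lookup_sum lookup_single when_def in_keys_iff)

lemma mpoly_eval_mult: "mpoly_eval x (f * g) = mpoly_eval x f * mpoly_eval x g"
proof -
  define mon where "mon = (\<lambda>m. \<Prod>i\<in>Poly_Mapping.keys m. x i ^ Poly_Mapping.lookup m i)"
  have mon: "mon m = (\<Prod>i\<in>S. x i ^ Poly_Mapping.lookup m i)"
    if "finite S" "Poly_Mapping.keys m \<subseteq> S" for m S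
    unfolding mon_def using that by (intro prod.mono_neutral_left) (auto simp: in_keys_iff)
  have mon_add: "mon (m + m') = mon m * mon m'" for m m'
  proof -
    let ?S = "Poly_Mapping.keys m \<union> Poly_Mapping.keys m'"
    have "finite ?S" by simp
    then show ?thesis
      using Poly_Mapping.keys_add[of m m']
      by (simp add: mon[of ?S] lookup_add power_add prod.distrib)
  qed
  have "f * g = (\<Sum>m\<in>Poly_Mapping.keys f. Poly_Mapping.single m (Poly_Mapping.lookup f m)) *
      (\<Sum>m\<in>Poly_Mapping.keys g. Poly_Mapping.single m (Poly_Mapping.lookup g m))"
    by (simp flip: mpoly_eq_sum_single)
  then have "mpoly_eval x (f * g) = (\<Sum>a\<in>Poly_Mapping.keys f. \<Sum>b\<in>Poly_Mapping.keys g.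
      to_ac (Poly_Mapping.lookup f a * Poly_Mapping.lookup g b) * mon (a + b))"
    by (simp only: sum_product mult_single mpoly_eval_sum mpoly_eval_single mon_def)
  moreover have "mpoly_eval x h = (\<Sum>a\<in>Poly_Mapping.keys h. to_ac (Poly_Mapping.lookup h a) * mon a)" for h
    by (simp only: mpoly_eval_def mon_def)
  ultimately show ?thesis
    by (simp add: mon_add sum_product mult_ac)
qed

lemma mpoly_eval_power: "mpoly_eval x (f ^ k) = mpoly_eval x f ^ k"
proof (induction k)
  case 0
  show ?case using mpoly_eval_Const[of x 1] by (simp add: Const_def)
qed (simp add: mpoly_eval_mult)

lemma mpoly_eval_subst_poly:
  "mpoly_eval x (subst_poly g f) = poly (map_poly to_ac g) (mpoly_eval x f)"
proof (induction g)
  case 0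
  show ?case by (simp add: subst_poly_def mpoly_eval_def)
next
  case (pCons a g)
  then show ?case
    by (simp add: subst_poly_def map_poly_pCons Const_def[of 0] mpoly_eval_add mpoly_eval_mult mpoly_eval_Const)
qed

lemma poly_map_eval_Psi:
  assumes "n \<ge> 2"
  shows "poly_map_eval n (Psi p g e n) x =
    (\<lambda>i\<in>{1..n}. if i = 1 then x 1 + (x 2 * poly (map_poly to_ac g) (x 1)) ^ (p ^ e) else x i)"
  using assms
  by (auto simp: poly_map_eval_def Psi_def mpoly_eval_add mpoly_eval_power mpoly_eval_mult
      mpoly_eval_subst_poly mpoly_eval_Var)

lemma Psi_in_poly_maps:
  fixes g :: "'a::comm_ring_1 poly"
  assumes "n \<ge> 2"
  shows "Psi p g e n \<in> poly_maps n"
proof -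
  have add: "f + h \<in> mpolys n" if "f \<in> mpolys n" "h \<in> mpolys n" for f h :: "'a mpoly"
    using that Poly_Mapping.keys_add[of f h] by (auto simp: mpolys_def)
  have mult: "f * h \<in> mpolys n" if "f \<in> mpolys n" "h \<in> mpolys n" for f h :: "'a mpoly"
  proof -
    have "Poly_Mapping.keys m \<subseteq> {1..n}" if m: "m \<in> Poly_Mapping.keys (f * h)" for m
    proof -
      obtain a b where "m = a + b" "a \<in> Poly_Mapping.keys f" "b \<in> Poly_Mapping.keys h"
        using m Poly_Mapping.keys_mult[of f h] by blast
      then show ?thesis
        using \<open>f \<in> mpolys n\<close> \<open>h \<in> mpolys n\<close> Poly_Mapping.keys_add[of a b]
        unfolding mpolys_def by blast
    qed
    then show ?thesis by (auto simp: mpolys_def)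
  qed
  have const: "Const c \<in> mpolys n" for c :: 'a
    by (auto simp: mpolys_def Const_def)
  have pow: "f ^ k \<in> mpolys n" if "f \<in> mpolys n" for f :: "'a mpoly" and k
    by (induction k) (use that mult const[of 1] in \<open>auto simp: Const_def\<close>)
  have var: "(Var i :: 'a mpoly) \<in> mpolys n" if "i \<in> {1..n}" for i
    using that by (auto simp: mpolys_def Var_def)
  have subst: "subst_poly g f \<in> mpolys n" if "f \<in> mpolys n" for f
  proof (induction g)
    case 0
    show ?case by (simp add: subst_poly_def mpolys_def)
  next
    case (pCons a g)
    then show ?case
      using add[OF const mult[OF that]]
      by (simp add: subst_poly_def map_poly_pCons Const_def[of 0])
  qed
  have v: "(Var 1 :: 'a mpoly) \<in> mpolys n" "(Var 2 :: 'a mpoly) \<in> mpolys n"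
    using assms by (auto intro: var)
  have "Var 1 + (Var 2 * subst_poly g (Var 1)) ^ (p ^ e) \<in> mpolys n"
    by (intro add[OF v(1)] pow mult[OF v(2)] subst v(1))
  then show ?thesis
    unfolding poly_maps_def Psi_def using var by (intro restrict_PiE_iff[THEN iffD2]) simp
qed

end

theory Submission
  imports Defs
begin

text \<open>
  Write \<open>K\<close> for the field with \<open>q ^ m\<close> elements and \<open>g\<close> for \<open>g\<^sub>D\<close>. If \<open>m \<in> D\<close>, then \<open>m\<close> divides
  a maximal element of \<open>D\<close>, so \<open>g\<close> vanishes on \<open>K\<close> and the map is the identity on \<open>K\<^sup>n\<close>. If
  \<open>m \<notin> D\<close>, then an element \<open>a \<in> K\<close> lying in no proper subfield satisfies \<open>g(a) \<noteq> 0\<close>. The Frobenius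
  map being bijective on \<open>K\<close>, some \<open>y\<close> has \<open>(y g(a)) ^ p ^ e = - a\<close>, and the distinct points
  \<open>(a, y, 0, \<dots>, 0)\<close> and \<open>(0, y, 0, \<dots>, 0)\<close> have the same image.
\<close>

section \<open>Subfields of the algebraic closure: inclusions, Frobenius roots, generators\<close>

lemma ext_field_0_mem: "0 \<in> ext_field m"
  by (simp add: ext_field_def power_0_left)

lemma ext_field_dvd_mono:
  assumes "d dvd m"
  shows "(ext_field d :: 'a::{field,finite} alg_closure set) \<subseteq> ext_field m"
proof
  fix x :: "'a alg_closure"
  assume "x \<in> ext_field d"
  then have x: "x ^ (CARD('a) ^ d) = x" by (simp add: ext_field_def)
  obtain k where k: "m = d * k" using assms ..
  have "x ^ (CARD('a) ^ d) ^ j = x" for j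
    by (induction j) (simp_all add: power_mult x)
  then show "x \<in> ext_field m"
    by (simp add: ext_field_def k power_mult)
qed

text \<open>Euclid's algorithm on Frobenius exponents: an element fixed by the \<open>d\<close>-th
  iterate is fixed by every multiple of it, so of the \<open>m\<close>-th iterate only the remainder
  \<open>m mod d\<close> survives.\<close>

lemma ext_field_gcd:
  fixes x :: "'a::{field,finite} alg_closure"
  shows "x \<in> ext_field m \<Longrightarrow> x \<in> ext_field d \<Longrightarrow> x \<in> ext_field (gcd m d)"
proof (induction m d rule: gcd_nat_induct)
  case (step m d)
  have "x \<in> ext_field (d * (m div d))"
    using ext_field_dvd_mono[of d "d * (m div d)"] step.prems by auto
  then have "x ^ (CARD('a) ^ (d * (m div d) + m mod d)) = x ^ (CARD('a) ^ (m mod d))"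
    by (simp only: ext_field_def mem_Collect_eq power_add power_mult)
  then have "x \<in> ext_field (m mod d)"
    using step.prems(1) by (simp add: ext_field_def)
  then show ?case
    using step.IH step.prems(2) by (simp add: gcd_red_nat[of m d])
qed simp

lemma ext_field_closed:
  fixes x y :: "'a::{field,finite} alg_closure"
  assumes "prime p" "CARD('a) = p ^ r"
  shows "x \<in> ext_field m \<Longrightarrow> y \<in> ext_field m \<Longrightarrow> x + y \<in> ext_field m"
    and "x \<in> ext_field m \<Longrightarrow> y \<in> ext_field m \<Longrightarrow> x * y \<in> ext_field m"
    and "x \<in> ext_field m \<Longrightarrow> - x \<in> ext_field m"
    and "x \<in> ext_field m \<Longrightarrow> y \<in> ext_field m \<Longrightarrow> x / y \<in> ext_field m"
proof -
  note S = subringE[OF subfieldE(1)[OF subfield_ext_field[OF assms]],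
      unfolded ring_of_type_algebra_simps]
  show "x \<in> ext_field m \<Longrightarrow> y \<in> ext_field m \<Longrightarrow> x + y \<in> ext_field m"
    by (rule S(7))
  show "x \<in> ext_field m \<Longrightarrow> y \<in> ext_field m \<Longrightarrow> x * y \<in> ext_field m"
    by (rule S(6))
  show "x \<in> ext_field m \<Longrightarrow> - x \<in> ext_field m"
    by (rule S(5))
  show "x \<in> ext_field m \<Longrightarrow> y \<in> ext_field m \<Longrightarrow> x / y \<in> ext_field m"
    by (simp add: ext_field_def power_divide)
qed

lemma to_ac_in_ext_field: "to_ac (c :: 'a::{field,finite}) \<in> ext_field m"
proof -
  interpret R: Ring.field "ring_of_type_algebra :: 'a ring" by (rule field_from_type_algebra)
  have "subfield (UNIV :: 'a set) ring_of_type_algebra"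
    using R.carrier_is_subfield by (simp add: ring_of_type_algebra_simps)
  then have "c ^ CARD('a) = c"
    by (rule pow_card_subfield) simp_all
  then have "to_ac c \<in> ext_field 1"
    by (simp add: ext_field_def flip: to_ac_power)
  then show ?thesis
    using ext_field_dvd_mono[of 1 m] by auto
qed

lemma poly_in_ext_field:
  fixes g :: "'a::{field,finite} poly"
  assumes "prime p" "CARD('a) = p ^ r" "x \<in> ext_field m"
  shows "poly (map_poly to_ac g) x \<in> ext_field m"
proof (induction g)
  case (pCons a g)
  then show ?case
    by (simp add: map_poly_pCons ext_field_closed[OF assms(1,2)] to_ac_in_ext_field assms(3))
qed (simp add: ext_field_0_mem)

lemma ext_field_pth_root:
  fixes b :: "'a::{field,finite} alg_closure"
  assumes "prime p" "CARD('a) = p ^ r" "r > 0" "m > 0" "b \<in> ext_field m"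
  obtains z where "z \<in> ext_field m" "z ^ (p ^ e) = b"
proof
  \<comment> \<open>On \<open>p ^ (r * m)\<close> elements, the inverse of raising to the power
    \<open>p\<close> is raising to the power \<open>p ^ (r * m - 1)\<close>; \<open>?k\<close>
    iterates this \<open>e\<close> times. The product \<open>?k * p ^ e\<close> is
    \<open>(CARD('a) ^ m) ^ e\<close>, which fixes \<open>b\<close> for \<open>e\<close> of any
    size.\<close>
  let ?k = "(p ^ (r * m - 1)) ^ e"
  have b: "b ^ (CARD('a) ^ m) = b"
    using assms(5) by (simp add: ext_field_def)
  have "p ^ (r * m - 1) * p = CARD('a) ^ m"
    using assms(3,4) by (simp only: assms(2) power_mult[symmetric]) (simp add: power_minus_mult del: One_nat_def)
  moreover have "b ^ (CARD('a) ^ m) ^ j = b" for j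
    by (induction j) (simp_all add: power_mult b)
  ultimately show "(b ^ ?k) ^ (p ^ e) = b"
    by (metis power_mult power_mult_distrib)
  show "b ^ ?k \<in> ext_field m"
    unfolding ext_field_def mem_Collect_eq by (metis b power_mult mult.commute)
qed

text \<open>A counting argument: the fields of degree below \<open>m\<close> together have too few
  elements to cover the field of degree \<open>m\<close>.\<close>

lemma ext_field_generator:
  assumes "prime p" "CARD('a::{field,finite}) = p ^ r" "m > 0"
  obtains a :: "'a::{field,finite} alg_closure"
  where "a \<in> ext_field m" "\<And>d. d > 0 \<Longrightarrow> a \<in> ext_field d \<Longrightarrow> m dvd d"
proof -
  let ?E = "ext_field :: nat \<Rightarrow> 'a alg_closure set"
  have c: "card (?E k) = CARD('a) ^ k" if "k > 0" for k
    using assms(1,2) that by (rule card_ext_field)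
  have q: "CARD('a) \<ge> 2"
    using card_mono[of UNIV "{0,1::'a}"] by simp
  have sum_less: "(\<Sum>k<j. CARD('a) ^ k) < CARD('a) ^ j" for j
  proof (induction j)
    case (Suc j)
    then have "(\<Sum>k<Suc j. CARD('a) ^ k) < 2 * CARD('a) ^ j" by simp
    also have "\<dots> \<le> CARD('a) ^ Suc j" using q by simp
    finally show ?case .
  qed simp
  have fin: "finite (?E k)" if "k > 0" for k
    using c[OF that] by (metis card.infinite power_not_zero zero_less_card_finite less_irrefl)
  \<comment> \<open>All degrees below \<open>m\<close> are taken, not only divisors of
    \<open>m\<close>; the geometric sum still suffices. Degree 0 is left out because
    \<open>ext_field 0\<close>, given by \<open>x ^ 1 = x\<close>, is the whole closure.\<close>
  have "card (\<Union>k\<in>{0<..<m}. ?E k) \<le> (\<Sum>k\<in>{0<..<m}. card (?E k))"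
    by (rule card_UN_le) simp
  also have "\<dots> = (\<Sum>k\<in>{0<..<m}. CARD('a) ^ k)"
    by (rule sum.cong) (simp_all add: c)
  also have "\<dots> \<le> (\<Sum>k<m. CARD('a) ^ k)"
    by (rule sum_mono2) auto
  also have "\<dots> < card (?E m)"
    using sum_less[of m] c[OF assms(3)] by simp
  finally have "\<not> ?E m \<subseteq> (\<Union>k\<in>{0<..<m}. ?E k)"
    using fin by (metis (no_types, lifting) card_mono finite_UN_I finite_greaterThanLessThan
        greaterThanLessThan_iff not_less)
  then obtain a where a: "a \<in> ?E m" "a \<notin> (\<Union>k\<in>{0<..<m}. ?E k)"
    by blast
  have "m dvd d" if "d > 0" "a \<in> ?E d" for d
  proof -
    \<comment> \<open>This replaces an arbitrary \<open>d\<close> by a positive degree at most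
      \<open>m\<close>, which by the choice of \<open>a\<close> cannot be smaller than
      \<open>m\<close>.\<close>
    have "a \<in> ?E (gcd m d)" using a(1) that(2) by (rule ext_field_gcd)
    then have "\<not> gcd m d < m" using a(2) assms(3) by auto
    moreover have "gcd m d \<le> m" using assms(3) by (simp add: gcd_le1_nat)
    ultimately have "gcd m d = m" by simp
    then show ?thesis by (metis gcd_dvd2)
  qed
  with a(1) show thesis by (rule that)
qed

section \<open>Maximal elements of \<open>D\<close> and the roots of \<open>g_D\<close>\<close>

lemma max_div_above:
  assumes "finite D" "0 \<notin> D" "m \<in> D"
  obtains d where "d \<in> max_div D" "m dvd d"
proof
  \<comment> \<open>The numerically largest multiple of \<open>m\<close> in \<open>D\<close> is
    maximal for divisibility: an element of \<open>D\<close> that it divides is again in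
    \<open>?S\<close> and, being nonzero, at least as large.\<close>
  let ?S = "{d \<in> D. m dvd d}"
  have S: "finite ?S" "m \<in> ?S" using assms by auto
  then have M: "Max ?S \<in> ?S" by (intro Max_in) auto
  then show "m dvd Max ?S" by simp
  have "d' = Max ?S" if "d' \<in> D" "Max ?S dvd d'" for d'
  proof (rule antisym)
    show "d' \<le> Max ?S" using that M S by (intro Max_ge) (auto intro: dvd_trans)
    show "Max ?S \<le> d'" using that assms(2) by (intro dvd_imp_le) (auto intro!: gr0I)
  qed
  then show "Max ?S \<in> max_div D" using M by (simp add: max_div_def)
qed

lemma map_poly_to_ac_mult: "map_poly to_ac (f * g) = map_poly to_ac f * map_poly to_ac g"
  by (rule poly_eqI) (simp add: coeff_map_poly coeff_mult to_ac_sum)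

lemma poly_to_ac_dvd:
  assumes "f dvd g" "poly (map_poly to_ac f) x = 0"
  shows "poly (map_poly to_ac g) x = 0"
  using assms by (auto simp: map_poly_to_ac_mult elim!: dvdE)

lemma poly_to_ac_field_poly:
  "poly (map_poly to_ac (monom 1 (CARD('a::{field,finite}) ^ d) - monom 1 1 :: 'a::{field,finite} poly)) x = 0
    \<longleftrightarrow> x \<in> ext_field d"
proof -
  have "map_poly to_ac (monom 1 (CARD('a) ^ d) - monom 1 1 :: 'a poly) =
      monom 1 (CARD('a) ^ d) - monom 1 1"
    by (rule poly_eqI) (simp add: coeff_map_poly)
  then show ?thesis by (simp add: poly_monom ext_field_def)
qed

text \<open>Each factor divides the lcm, and the lcm divides the product of the factors; the roots
  of that product are just those of the factors, so the lcm has the same ones.\<close>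

lemma g_D_root_iff:
  fixes x :: "'a::{field,finite} alg_closure"
  assumes "finite D" "0 \<notin> D"
  shows "poly (map_poly to_ac (g_D D :: 'a poly)) x = 0 \<longleftrightarrow> (\<exists>d\<in>max_div D. x \<in> ext_field d)"
proof -
  define f :: "nat \<Rightarrow> 'a poly" where "f d = monom 1 (CARD('a) ^ d) - monom 1 1" for d
  have root: "poly (map_poly to_ac (f d)) x = 0 \<longleftrightarrow> x \<in> ext_field d" for d
    unfolding f_def by (rule poly_to_ac_field_poly)
  have sub: "max_div D \<subseteq> D" by (auto simp: max_div_def)
  then have fin: "finite (max_div D)" using assms(1) by (rule finite_subset)
  have q: "CARD('a) > 1"
    using card_mono[of UNIV "{0,1::'a}"] by simp
  have nz: "f d \<noteq> 0" if "d \<in> max_div D" for d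
  proof -
    have "d > 0"
      using that sub assms(2) by (auto intro!: gr0I)
    \<comment> \<open>As \<open>q ^ d > 1\<close> for positive \<open>d\<close>, the two monomials
      have different degrees and cannot cancel.\<close>
    then have "coeff (f d) 1 = -1" using q by (simp add: f_def)
    then show ?thesis by auto
  qed
  have lcm: "is_monic_lcm (f ` max_div D) (g_D D)"
    unfolding g_D_def f_def[symmetric] using fin nz by (intro is_monic_lcm_monic_lcm) auto
  have prod: "poly (map_poly to_ac (\<Prod>d\<in>A. f d)) x = 0 \<longleftrightarrow> (\<exists>d\<in>A. x \<in> ext_field d)"
    if "finite A" for A
    using that by induction (simp_all add: map_poly_to_ac_mult root)
  have "g_D D dvd (\<Prod>d\<in>max_div D. f d)"
    using lcm fin by (auto simp: is_monic_lcm_def intro!: dvd_prodI)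
  moreover have "f d dvd g_D D" if "d \<in> max_div D" for d
    using lcm that by (simp add: is_monic_lcm_def)
  ultimately show ?thesis
    using prod[OF fin] root poly_to_ac_dvd by blast
qed

section \<open>\<open>Psi\<close> as a map on points over \<open>ext_field m\<close>\<close>

lemma Psi_bij_if_vanishes:
  fixes g :: "'a::{field,finite} poly"
  assumes "n \<ge> 2" "p > 0" "\<And>x. x \<in> ext_field m \<Longrightarrow> poly (map_poly to_ac g) x = 0"
  shows "bij_betw (poly_map_eval n (Psi p g e n)) ({1..n} \<rightarrow>\<^sub>E ext_field m) ({1..n} \<rightarrow>\<^sub>E ext_field m)"
proof -
  have "poly_map_eval n (Psi p g e n) x = x" if "x \<in> {1..n} \<rightarrow>\<^sub>E ext_field m" for x
  proof -
    have "x 1 \<in> ext_field m" using that assms(1) by auto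
    then have "poly_map_eval n (Psi p g e n) x = restrict x {1..n}"
      using assms by (auto simp: poly_map_eval_Psi power_0_left)
    then show ?thesis
      using that by (simp only: PiE_restrict)
  qed
  then show ?thesis
    by (simp add: bij_betw_cong[where g = "\<lambda>x. x"] bij_betw_id[unfolded id_def])
qed

lemma Psi_not_inj:
  fixes g :: "'a::{field,finite} poly"
  assumes "prime p" "CARD('a) = p ^ r" "r > 0" "m > 0" "n \<ge> 2"
    and "poly g 0 = 0" "a \<in> ext_field m" "poly (map_poly to_ac g) a \<noteq> 0"
  shows "\<not> inj_on (poly_map_eval n (Psi p g e n)) ({1..n} \<rightarrow>\<^sub>E ext_field m)"
proof
  let ?g = "poly (map_poly to_ac g)"
  assume inj: "inj_on (poly_map_eval n (Psi p g e n)) ({1..n} \<rightarrow>\<^sub>E ext_field m)"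
  have p: "p > 0" using assms(1) by (rule prime_gt_0_nat)
  have g0: "?g 0 = 0"
    using assms(6) by (simp add: poly_0_coeff_0 coeff_map_poly)
  have "a \<noteq> 0" using g0 assms(8) by auto
  have "- a \<in> ext_field m"
    using assms(1,2,7) by (intro ext_field_closed)
  then obtain z where z: "z \<in> ext_field m" "z ^ (p ^ e) = - a"
    using ext_field_pth_root[OF assms(1-4)] by metis
  \<comment> \<open>Chosen so that \<open>y * ?g a = z\<close>, whose power \<open>p ^ e\<close> is
    \<open>- a\<close>.\<close>
  define y where "y = z / ?g a"
  have y: "y \<in> ext_field m"
    unfolding y_def using assms(1,2,7) z(1) by (intro ext_field_closed poly_in_ext_field)
  define u where "u t = (\<lambda>i\<in>{1..n}. if i = 1 then t else if i = 2 then y else 0)" for t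
  have u: "u t \<in> {1..n} \<rightarrow>\<^sub>E ext_field m" if "t \<in> ext_field m" for t
    using that y by (auto simp: u_def ext_field_0_mem)
  \<comment> \<open>Both first coordinates become 0: at \<open>a\<close> by the choice of
    \<open>y\<close>, at 0 because \<open>?g 0 = 0\<close>.\<close>
  have "poly_map_eval n (Psi p g e n) (u a) = poly_map_eval n (Psi p g e n) (u 0)"
    using assms(5,8) g0 z(2) p
    by (auto simp: poly_map_eval_Psi u_def y_def power_0_left fun_eq_iff)
  then have "u a = u 0"
    using inj u[OF assms(7)] u[OF ext_field_0_mem] by (simp add: inj_on_def)
  then have "u a 1 = u 0 1" by simp
  then show False
    using \<open>a \<noteq> 0\<close> assms(5) by (simp add: u_def)
qed

theorem theorem4p1:
  fixes D :: "nat set" and p q r e n :: nat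
  assumes D: "finite D" "D \<noteq> {}" "D \<subseteq> {m. m > 0}" "divisor_closed D"
    and q: "prime p" "r \<ge> 1" "q = p ^ r"
    and Fq: "CARD('a::{field,finite}) = q"
    and e: "e \<ge> 1"
    and n: "n \<ge> 2"
  shows "(\<exists>g :: 'a poly. poly g 0 = 0 \<and> spectrum n (Psi p g e n) = D) \<and>
    poly (g_D D :: 'a poly) 0 = 0 \<and> spectrum n (Psi p (g_D D :: 'a poly) e n) = D"
proof -
  let ?g = "g_D D :: 'a poly"
  have D0: "0 \<notin> D" using D(3) by auto
  have card: "CARD('a) = p ^ r" using Fq q(3) by simp
  have r: "r > 0" using q(2) by simp
  have root: "poly (map_poly to_ac ?g) x = 0 \<longleftrightarrow> (\<exists>d\<in>max_div D. x \<in> ext_field d)" for x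
    using D(1) D0 by (rule g_D_root_iff)
  have vanish: "poly (map_poly to_ac ?g) x = 0" if "m \<in> D" "x \<in> ext_field m" for m x
  proof -
    obtain d where "d \<in> max_div D" "m dvd d"
      using max_div_above[OF D(1) D0 \<open>m \<in> D\<close>] .
    then show ?thesis
      using \<open>x \<in> ext_field m\<close> ext_field_dvd_mono[of m d] root by auto
  qed
  \<comment> \<open>Any element of the nonempty \<open>D\<close> gives a field containing 0 on which
    \<open>?g\<close> vanishes.\<close>
  have "poly (map_poly to_ac ?g) 0 = 0"
    using D(2) vanish ext_field_0_mem by blast
  then have g0: "poly ?g 0 = 0"
    by (simp add: poly_0_coeff_0 coeff_map_poly)
  have "m \<in> spectrum n (Psi p ?g e n) \<longleftrightarrow> m \<in> D" for m
  proof
    assume "m \<in> D"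
    then show "m \<in> spectrum n (Psi p ?g e n)"
      using Psi_bij_if_vanishes[OF n prime_gt_0_nat[OF q(1)] vanish] D(3)
      by (auto simp: spectrum_def)
  next
    assume "m \<in> spectrum n (Psi p ?g e n)"
    then have m: "m > 0"
      and inj: "inj_on (poly_map_eval n (Psi p ?g e n)) ({1..n} \<rightarrow>\<^sub>E ext_field m)"
      by (auto simp: spectrum_def bij_betw_def)
    obtain a :: "'a alg_closure" where a: "a \<in> ext_field m"
      and gen: "\<And>d. d > 0 \<Longrightarrow> a \<in> ext_field d \<Longrightarrow> m dvd d"
      using ext_field_generator[OF q(1) card m] by metis
    have "poly (map_poly to_ac ?g) a = 0"
      using Psi_not_inj[OF q(1) card r m n g0 a] inj by blast
    then obtain d where "d \<in> D" "a \<in> ext_field d"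
      unfolding root by (auto simp: max_div_def)
    \<comment> \<open>Since \<open>d\<close> is positive, \<open>gen\<close> yields
      \<open>m dvd d\<close>, and divisor closure passes from \<open>d\<close> to
      \<open>m\<close>.\<close>
    then show "m \<in> D"
      using gen[of d] D(3,4) by (auto simp: divisor_closed_def)
  qed
  then have "spectrum n (Psi p ?g e n) = D" by blast
  then show ?thesis using g0 by blast
qed

end
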